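(* Let $\boldsymbol{X}=(X_1,\dots,X_d)$ follow the multivariate common shock Poisson distribution with parameters $(\theta_0,\theta_1,\dots,\theta_d)\in(0,\infty)^{d+1}$, with $X_j=Y_0+Y_j$. Then for every $x\in\mathbb N=\{0,1,2,\dots\}$, as $\theta_0\to\infty$ with all other parameters fixed, $$F_{M^{\boldsymbol X}}(x)\sim e^{-\sum_{j=1}^{d}\theta_j}F_{Y_0}(x),\qquad F_{m^{\boldsymbol X}}(x)\sim\left[1-\prod_{j=1}^{d}\left(1-e^{-\theta_j}\right)\right]F_{Y_0}(x).$$
   Context: A random vector $(X_1,\dots,X_d)$ has the multivariate common shock Poisson distribution with parameters $(\theta_0,\theta_1,\dots,\theta_d)\in(0,\infty)^{d+1}$ if $X_j=Y_0+Y_j$ for $j=1,\dots,d$, where $Y_0,Y_1,\dots,Y_d$ are mutually independent and $Y_j$ is Poisson distributed with rate $\theta_j$, $j=0,1,\dots,d$. $M^{\boldsymbol X}=\max(X_1,\dots,X_d)$, $m^{\boldsymbol X}=\min(X_1,\dots,X_d)$, and $F_W$ denotes the cumulative distribution function of a random variable $W$. The notation $f(x;\kappa)\sim g(x;\kappa)$ as $\kappa\to\kappa_0$ means $\lim_{\kappa\to\kappa_0}f(x;\kappa)/g(x;\kappa)=1$. *)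

theory Defs
  imports "HOL-Probability.Probability"
begin

(* The components of X are indexed by 1, ..., d, those of Y and theta by 0, ..., d;
   values at other indices are irrelevant. *)
definition common_shock_poisson ::
  "'a measure \<Rightarrow> nat \<Rightarrow> (nat \<Rightarrow> real) \<Rightarrow> (nat \<Rightarrow> 'a \<Rightarrow> nat) \<Rightarrow> (nat \<Rightarrow> 'a \<Rightarrow> nat) \<Rightarrow> bool"
where
  "common_shock_poisson M d \<theta> Y X \<longleftrightarrow>
     prob_space M \<and>
     (\<forall>j\<in>{0..d}. 0 < \<theta> j) \<and>
     prob_space.indep_vars M (\<lambda>_. count_space UNIV) Y {0..d} \<and>
     (\<forall>j\<in>{0..d}. distr M (count_space UNIV) (Y j) = measure_pmf (poisson_pmf (\<theta> j))) \<and>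
     (\<forall>j\<in>{1..d}. \<forall>\<omega>\<in>space M. X j \<omega> = Y 0 \<omega> + Y j \<omega>)"

definition max_rv :: "nat \<Rightarrow> (nat \<Rightarrow> 'a \<Rightarrow> nat) \<Rightarrow> 'a \<Rightarrow> nat" where
  "max_rv d X \<omega> = Max ((\<lambda>j. X j \<omega>) ` {1..d})"

definition min_rv :: "nat \<Rightarrow> (nat \<Rightarrow> 'a \<Rightarrow> nat) \<Rightarrow> 'a \<Rightarrow> nat" where
  "min_rv d X \<omega> = Min ((\<lambda>j. X j \<omega>) ` {1..d})"

definition rv_cdf :: "'a measure \<Rightarrow> ('a \<Rightarrow> nat) \<Rightarrow> real \<Rightarrow> real" where
  "rv_cdf M W = cdf (distr M borel (\<lambda>\<omega>. real (W \<omega>)))"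

end

theory Submission
  imports Defs
begin

text \<open>
  Conditioning on the common shock, both distribution functions at \<open>x\<close> have the form
  \<open>\<Sum>k\<le>x. P(Y\<^sub>0 = k) * c k\<close>, where the weights \<open>c k\<close> depend only on
  \<open>\<theta>\<^sub>1, \<dots>, \<theta>\<^sub>d\<close>. As the rate of the shock tends to infinity, its law conditioned on
  \<open>{..x}\<close> concentrates at \<open>x\<close>, because \<open>P(Y\<^sub>0 = k) / P(Y\<^sub>0 = x)\<close> tends to 0 for \<open>k < x\<close>.
  The ratio to \<open>P(Y\<^sub>0 \<le> x)\<close> therefore tends to \<open>c x\<close>.
\<close>

lemma tendsto_poisson_weighted_average:
  fixes c :: "nat \<Rightarrow> real"
  shows "((\<lambda>t. (\<Sum>k\<le>n. pmf (poisson_pmf t) k * c k) / (\<Sum>k\<le>n. pmf (poisson_pmf t) k))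
           \<longlongrightarrow> c n) at_top"
proof -
  \<comment> \<open>Normalising by the mass at \<open>n\<close> cancels the factor
    \<open>exp (- t)\<close>: for \<open>t > 0\<close> the quotient is
    \<open>fact n / fact k * inverse (t ^ (n - k))\<close>, which vanishes in the limit unless
    \<open>k = n\<close>.\<close>
  define r where "r k t = pmf (poisson_pmf t) k / pmf (poisson_pmf t) n" for k t
  have r: "(r k \<longlongrightarrow> (if k = n then 1 else 0)) at_top" if "k \<le> n" for k
  proof -
    have "((\<lambda>t::real. fact n / fact k * inverse (t ^ (n - k))) \<longlongrightarrow> (if k = n then 1 else 0)) at_top"
    proof (cases "k = n")
      case False
      with that have "filterlim (\<lambda>t::real. t ^ (n - k)) at_top at_top"
        by (intro filterlim_pow_at_top filterlim_ident) auto
      from tendsto_mult_right_zero[OF tendsto_inverse_0_at_top[OF this], of "fact n / fact k"]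
      show ?thesis using False by simp
    qed simp
    moreover have "eventually (\<lambda>t. fact n / fact k * inverse (t ^ (n - k)) = r k t) at_top"
      using eventually_gt_at_top[of 0]
      by eventually_elim (use that in \<open>simp add: r_def field_simps flip: power_add\<close>)
    ultimately show ?thesis
      by (rule Lim_transform_eventually)
  qed
  \<comment> \<open>Needed twice: with \<open>a = c\<close> for the numerator and with
    \<open>a\<close> constantly 1 for the denominator.\<close>
  have lim: "((\<lambda>t. \<Sum>k\<le>n. r k t * a k) \<longlongrightarrow> a n) at_top" for a :: "nat \<Rightarrow> real"
  proof -
    have "((\<lambda>t. \<Sum>k\<le>n. r k t * a k) \<longlongrightarrow> (\<Sum>k\<le>n. (if k = n then 1 else 0) * a k)) at_top"
      by (intro tendsto_intros r) auto
    also have "(\<Sum>k\<le>n. (if k = n then 1 else 0) * a k) = a n"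
      by (simp add: if_distrib[of "\<lambda>z. z * _"] cong: if_cong)
    finally show ?thesis .
  qed
  have "((\<lambda>t. (\<Sum>k\<le>n. r k t * c k) / (\<Sum>k\<le>n. r k t * 1)) \<longlongrightarrow> c n / 1) at_top"
    by (intro tendsto_divide lim) simp
  moreover have "eventually (\<lambda>t. (\<Sum>k\<le>n. r k t * c k) / (\<Sum>k\<le>n. r k t * 1) =
      (\<Sum>k\<le>n. pmf (poisson_pmf t) k * c k) / (\<Sum>k\<le>n. pmf (poisson_pmf t) k)) at_top"
    using eventually_gt_at_top[of 0]
  proof eventually_elim
    case (elim t)
    have "(\<Sum>k\<le>n. r k t * a k) = (\<Sum>k\<le>n. pmf (poisson_pmf t) k * a k) / pmf (poisson_pmf t) n" for a
      by (simp add: r_def sum_divide_distrib)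
    from this[of c] this[of "\<lambda>_. 1"] elim show ?case
      by simp
  qed
  ultimately show ?thesis
    by (auto intro: Lim_transform_eventually)
qed

lemma rv_cdf_eq_measure:
  assumes "W \<in> measurable M (count_space UNIV)"
  shows "rv_cdf M W (real x) = measure M {\<omega>\<in>space M. W \<omega> \<le> x}"
proof -
  have "(\<lambda>\<omega>. real (W \<omega>)) \<in> borel_measurable M"
    using assms by measurable
  then show ?thesis
    by (auto simp: rv_cdf_def cdf_def2 measure_distr intro!: arg_cong[of _ _ "measure M"])
qed

lemma max_rv_le_iff: "1 \<le> d \<Longrightarrow> max_rv d X \<omega> \<le> n \<longleftrightarrow> (\<forall>j\<in>{1..d}. X j \<omega> \<le> n)"
  by (simp add: max_rv_def)

lemma min_rv_le_iff: "1 \<le> d \<Longrightarrow> min_rv d X \<omega> \<le> n \<longleftrightarrow> (\<exists>j\<in>{1..d}. X j \<omega> \<le> n)"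
  by (simp add: min_rv_def Min_le_iff)

lemma measurable_max_rv:
  assumes "\<And>j. j \<in> {1..d} \<Longrightarrow> X j \<in> measurable M (count_space UNIV)"
  shows "max_rv d X \<in> measurable M (count_space UNIV)"
  \<comment> \<open>On \<open>nat\<close> every set is Borel, so Borel measurability is
    measurability into \<open>count_space UNIV\<close>.\<close>
  using borel_measurable_Max[of "{1..d}" X M] assms
  by (simp add: max_rv_def[abs_def] measurable_cong_sets[OF refl sets_borel_eq_count_space])

lemma measurable_min_rv:
  assumes "\<And>j. j \<in> {1..d} \<Longrightarrow> X j \<in> measurable M (count_space UNIV)"
  shows "min_rv d X \<in> measurable M (count_space UNIV)"
  using borel_measurable_Min[of "{1..d}" X M] assms
  by (simp add: min_rv_def[abs_def] measurable_cong_sets[OF refl sets_borel_eq_count_space])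

context
  fixes M :: "'a measure" and d :: nat and \<theta> :: "nat \<Rightarrow> real" and X Y :: "nat \<Rightarrow> 'a \<Rightarrow> nat"
  assumes csp: "common_shock_poisson M d \<theta> Y X"
begin

interpretation prob_space M
  using csp by (simp add: common_shock_poisson_def)

lemma measurable_shock: "j \<le> d \<Longrightarrow> Y j \<in> measurable M (count_space UNIV)"
  using csp by (auto simp: common_shock_poisson_def indep_vars_def2)

lemma measurable_component:
  assumes "j \<in> {1..d}"
  shows "X j \<in> measurable M (count_space UNIV)"
proof -
  have [measurable]: "Y 0 \<in> measurable M (count_space UNIV)"
    "Y j \<in> measurable M (count_space UNIV)"
    using assms by (auto intro: measurable_shock)
  have "(\<lambda>\<omega>. Y 0 \<omega> + Y j \<omega>) \<in> measurable M (count_space UNIV)"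
    by measurable
  moreover have "X j \<omega> = Y 0 \<omega> + Y j \<omega>" if "\<omega> \<in> space M" for \<omega>
    using csp assms that by (auto simp: common_shock_poisson_def)
  ultimately show ?thesis
    by (simp cong: measurable_cong)
qed

text \<open>Fixing the value of the common shock turns the event into a rectangle in the independent
  variables \<open>Y 0\<close>, ..., \<open>Y d\<close>, so its probability factorises.\<close>

lemma prob_shocks:
  "prob {\<omega>\<in>space M. Y 0 \<omega> = k \<and> (\<forall>j\<in>{1..d}. Y j \<omega> \<in> A)} =
     pmf (poisson_pmf (\<theta> 0)) k * (\<Prod>j=1..d. measure_pmf.prob (poisson_pmf (\<theta> j)) A)"
proof -
  define B where "B j = (if j = 0 then {k} else A)" for j :: nat
  have law: "prob (Y j -` C \<inter> space M) = measure_pmf.prob (poisson_pmf (\<theta> j)) C" if "j \<le> d" for j C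
  proof -
    have "measure_pmf (poisson_pmf (\<theta> j)) = distr M (count_space UNIV) (Y j)"
      using csp that by (auto simp: common_shock_poisson_def)
    then show ?thesis
      using measurable_shock[OF that] by (simp add: measure_distr)
  qed
  have "{\<omega>\<in>space M. Y 0 \<omega> = k \<and> (\<forall>j\<in>{1..d}. Y j \<omega> \<in> A)} = (\<Inter>j\<in>{0..d}. Y j -` B j \<inter> space M)"
    by (force simp: B_def)
  also have "prob \<dots> = (\<Prod>j=0..d. prob (Y j -` B j \<inter> space M))"
    using csp by (intro indep_varsD_finite) (auto simp: common_shock_poisson_def)
  also have "\<dots> = (\<Prod>j=0..d. measure_pmf.prob (poisson_pmf (\<theta> j)) (B j))"
    by (intro prod.cong) (auto simp: law)
  also have "\<dots> = pmf (poisson_pmf (\<theta> 0)) k * (\<Prod>j=1..d. measure_pmf.prob (poisson_pmf (\<theta> j)) A)"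
    by (simp add: prod.atLeast_Suc_atMost B_def measure_pmf_single)
  finally show ?thesis .
qed

text \<open>Total probability over the value \<open>k\<close> of the common shock. Letting
  \<open>A\<close> depend on \<open>k\<close> is what makes the formula usable for both the maximum
  and the minimum, whose thresholds for \<open>Y j\<close> are \<open>x - k\<close>.\<close>

lemma prob_shocks_le:
  "prob {\<omega>\<in>space M. Y 0 \<omega> \<le> x \<and> (\<forall>j\<in>{1..d}. Y j \<omega> \<in> A (Y 0 \<omega>))} =
     (\<Sum>k\<le>x. pmf (poisson_pmf (\<theta> 0)) k * (\<Prod>j=1..d. measure_pmf.prob (poisson_pmf (\<theta> j)) (A k)))"
proof -
  have m: "{\<omega>\<in>space M. Y 0 \<omega> = k \<and> (\<forall>j\<in>{1..d}. Y j \<omega> \<in> A k)} \<in> events" for k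
  proof -
    have [measurable]: "Y j \<in> measurable M (count_space UNIV)" if "j \<in> {0..d}" for j
      using that by (auto intro: measurable_shock)
    show ?thesis by measurable
  qed
  have "{\<omega>\<in>space M. Y 0 \<omega> \<le> x \<and> (\<forall>j\<in>{1..d}. Y j \<omega> \<in> A (Y 0 \<omega>))} =
      (\<Union>k\<in>{..x}. {\<omega>\<in>space M. Y 0 \<omega> = k \<and> (\<forall>j\<in>{1..d}. Y j \<omega> \<in> A k)})"
    by auto
  also have "prob \<dots> = (\<Sum>k\<le>x. prob {\<omega>\<in>space M. Y 0 \<omega> = k \<and> (\<forall>j\<in>{1..d}. Y j \<omega> \<in> A k)})"
    using m by (intro finite_measure_finite_Union) (auto simp: disjoint_family_on_def)
  finally show ?thesis
    by (simp only: prob_shocks)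
qed

lemma rv_cdf_shock: "rv_cdf M (Y 0) (real x) = (\<Sum>k\<le>x. pmf (poisson_pmf (\<theta> 0)) k)"
  \<comment> \<open>With \<open>A\<close> constantly \<open>UNIV\<close> every product is 1.\<close>
  using prob_shocks_le[of x "\<lambda>_. UNIV"] by (simp add: rv_cdf_eq_measure measurable_shock)

lemma rv_cdf_max:
  assumes "1 \<le> d"
  shows "rv_cdf M (max_rv d X) (real x) =
    (\<Sum>k\<le>x. pmf (poisson_pmf (\<theta> 0)) k * (\<Prod>j=1..d. measure_pmf.prob (poisson_pmf (\<theta> j)) {..x - k}))"
proof -
  have "max_rv d X \<omega> \<le> x \<longleftrightarrow> Y 0 \<omega> \<le> x \<and> (\<forall>j\<in>{1..d}. Y j \<omega> \<in> {..x - Y 0 \<omega>})"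
    if "\<omega> \<in> space M" for \<omega>
  proof -
    have "max_rv d X \<omega> \<le> x \<longleftrightarrow> (\<forall>j\<in>{1..d}. Y 0 \<omega> + Y j \<omega> \<le> x)"
      using csp that assms by (simp add: max_rv_le_iff common_shock_poisson_def)
    \<comment> \<open>Subtraction on \<open>nat\<close> truncates, so
      \<open>Y 0 \<omega> \<le> x\<close> has to be stated separately; it follows from the left-hand
      side because \<open>1 \<le> d\<close> provides some \<open>j\<close>.\<close>
    also have "\<dots> \<longleftrightarrow> Y 0 \<omega> \<le> x \<and> (\<forall>j\<in>{1..d}. Y j \<omega> \<in> {..x - Y 0 \<omega>})"
      using assms by (fastforce simp: le_diff_conv2 add.commute)
    finally show ?thesis .
  qed
  then have "{\<omega>\<in>space M. max_rv d X \<omega> \<le> x} =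
      {\<omega>\<in>space M. Y 0 \<omega> \<le> x \<and> (\<forall>j\<in>{1..d}. Y j \<omega> \<in> {..x - Y 0 \<omega>})}"
    by blast
  then show ?thesis
    using prob_shocks_le[of x "\<lambda>k. {..x - k}"]
    by (simp only: rv_cdf_eq_measure measurable_max_rv measurable_component)
qed

text \<open>The minimum is at most \<open>x\<close> if some component is, and an existential
  condition does not factorise. Inside \<open>{Y 0 \<le> x}\<close> its complement says that all
  \<open>Y j\<close> exceed \<open>x - Y 0\<close>, which does; hence the difference of two
  probabilities.\<close>

lemma rv_cdf_min:
  assumes "1 \<le> d"
  shows "rv_cdf M (min_rv d X) (real x) =
    (\<Sum>k\<le>x. pmf (poisson_pmf (\<theta> 0)) k *
      (1 - (\<Prod>j=1..d. measure_pmf.prob (poisson_pmf (\<theta> j)) {x - k<..})))"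
proof -
  let ?S = "{\<omega>\<in>space M. Y 0 \<omega> \<le> x}"
  let ?T = "{\<omega>\<in>space M. Y 0 \<omega> \<le> x \<and> (\<forall>j\<in>{1..d}. Y j \<omega> \<in> {x - Y 0 \<omega><..})}"
  have [measurable]: "Y j \<in> measurable M (count_space UNIV)" if "j \<in> {0..d}" for j
    using that by (auto intro: measurable_shock)
  have "min_rv d X \<omega> \<le> x \<longleftrightarrow> Y 0 \<omega> \<le> x \<and> \<not> (\<forall>j\<in>{1..d}. Y j \<omega> \<in> {x - Y 0 \<omega><..})"
    if "\<omega> \<in> space M" for \<omega>
  proof -
    have "min_rv d X \<omega> \<le> x \<longleftrightarrow> (\<exists>j\<in>{1..d}. Y 0 \<omega> + Y j \<omega> \<le> x)"
      using csp that assms by (simp add: min_rv_le_iff common_shock_poisson_def)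
    also have "\<dots> \<longleftrightarrow> Y 0 \<omega> \<le> x \<and> (\<exists>j\<in>{1..d}. Y j \<omega> \<le> x - Y 0 \<omega>)"
      by (fastforce simp: le_diff_conv2 add.commute)
    finally show ?thesis by (auto simp: not_less)
  qed
  then have "{\<omega>\<in>space M. min_rv d X \<omega> \<le> x} = ?S - ?T"
    by blast
  moreover have "?S \<in> events"
    by measurable
  moreover have "?T \<in> events"
    by measurable
  ultimately have "prob {\<omega>\<in>space M. min_rv d X \<omega> \<le> x} = prob ?S - prob ?T"
    by (simp only:) (rule finite_measure_Diff, auto)
  moreover have "prob ?S = (\<Sum>k\<le>x. pmf (poisson_pmf (\<theta> 0)) k)"
    using rv_cdf_shock by (simp add: rv_cdf_eq_measure)
  ultimately show ?thesis
    using prob_shocks_le[of x "\<lambda>k. {x - k<..}"]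
    by (simp only: rv_cdf_eq_measure measurable_min_rv measurable_component
      right_diff_distrib sum_subtractf mult_1_right)
qed

end

lemma measure_poisson_pmf_0: "0 < t \<Longrightarrow> measure_pmf.prob (poisson_pmf t) {0} = exp (- t)"
  by (simp add: measure_pmf_single)

lemma measure_poisson_pmf_pos:
  assumes "0 < t"
  shows "measure_pmf.prob (poisson_pmf t) {0<..} = 1 - exp (- t)"
proof -
  have "{0<..} = UNIV - {0::nat}"
    by auto
  then show ?thesis
    using measure_pmf.prob_compl[of "{0}" "poisson_pmf t"] assms
    by (simp only: measure_poisson_pmf_0) simp
qed

theorem proposition4p2:
  fixes d x :: nat
    and \<theta> :: "nat \<Rightarrow> real"
    and M :: "real \<Rightarrow> 'a measure"
    and X Y :: "real \<Rightarrow> nat \<Rightarrow> 'a \<Rightarrow> nat"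
  assumes "1 \<le> d"
    and "\<And>\<theta>\<^sub>0. 0 < \<theta>\<^sub>0 \<Longrightarrow>
           common_shock_poisson (M \<theta>\<^sub>0) d (\<theta>(0 := \<theta>\<^sub>0)) (Y \<theta>\<^sub>0) (X \<theta>\<^sub>0)"
  shows "((\<lambda>\<theta>\<^sub>0. rv_cdf (M \<theta>\<^sub>0) (max_rv d (X \<theta>\<^sub>0)) (real x) /
                (exp (- (\<Sum>j=1..d. \<theta> j)) * rv_cdf (M \<theta>\<^sub>0) (Y \<theta>\<^sub>0 0) (real x)))
           \<longlongrightarrow> 1) at_top \<and>
         ((\<lambda>\<theta>\<^sub>0. rv_cdf (M \<theta>\<^sub>0) (min_rv d (X \<theta>\<^sub>0)) (real x) /
                ((1 - (\<Prod>j=1..d. (1 - exp (- \<theta> j)))) * rv_cdf (M \<theta>\<^sub>0) (Y \<theta>\<^sub>0 0) (real x)))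
           \<longlongrightarrow> 1) at_top"
proof -
  \<comment> \<open>The hypothesis is taken at shock rate 1, an arbitrary positive choice: updating
    \<theta> at 0 leaves the other rates unchanged.\<close>
  have pos: "0 < \<theta> j" if "j \<in> {1..d}" for j
  proof -
    have "\<forall>j\<in>{0..d}. 0 < (\<theta>(0 := 1)) j"
      using assms(2)[of 1] unfolding common_shock_poisson_def by simp
    then show ?thesis
      using that by (auto dest: bspec[of _ _ j])
  qed
  define a where "a k = (\<Prod>j=1..d. measure_pmf.prob (poisson_pmf (\<theta> j)) {..x - k})" for k
  define b where "b k = 1 - (\<Prod>j=1..d. measure_pmf.prob (poisson_pmf (\<theta> j)) {x - k<..})" for k
  have a: "a x = exp (- (\<Sum>j=1..d. \<theta> j))"
    using pos by (simp add: a_def measure_poisson_pmf_0 exp_sum flip: sum_negf)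
  have b: "b x = 1 - (\<Prod>j=1..d. (1 - exp (- \<theta> j)))"
    using pos by (simp add: b_def measure_poisson_pmf_pos)
  \<comment> \<open>Each factor is strictly below 1 and \<open>1 \<le> d\<close> makes the product
    nonempty, so \<open>b x\<close> is positive.\<close>
  have "(\<Prod>j=1..d. (1 - exp (- \<theta> j))) < (\<Prod>j=1..d. 1)"
    using pos assms(1) by (intro prod_mono_strict[of 1]) (auto simp: less_imp_le)
  then have nz: "a x \<noteq> 0" "b x \<noteq> 0"
    by (simp_all add: a b)
  \<comment> \<open>The limit argument common to both claims: \<open>F\<close> stands for either
    distribution function as a function of the shock rate, \<open>c\<close> for its weights. The
    representation is only available for positive rates, which suffices at infinity.\<close>
  have key: "((\<lambda>t. F t / (c x * rv_cdf (M t) (Y t 0) (real x))) \<longlongrightarrow> 1) at_top"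
    if F: "\<And>t. 0 < t \<Longrightarrow> F t = (\<Sum>k\<le>x. pmf (poisson_pmf t) k * c k)" and "c x \<noteq> 0" for F c
  proof -
    have "((\<lambda>t. (\<Sum>k\<le>x. pmf (poisson_pmf t) k * c k) / (\<Sum>k\<le>x. pmf (poisson_pmf t) k) / c x)
        \<longlongrightarrow> c x / c x) at_top"
      by (intro tendsto_divide tendsto_poisson_weighted_average tendsto_const \<open>c x \<noteq> 0\<close>)
    moreover have "eventually (\<lambda>t. (\<Sum>k\<le>x. pmf (poisson_pmf t) k * c k) /
        (\<Sum>k\<le>x. pmf (poisson_pmf t) k) / c x = F t / (c x * rv_cdf (M t) (Y t 0) (real x))) at_top"
      using eventually_gt_at_top[of 0]
      by eventually_elim (simp add: F rv_cdf_shock[OF assms(2)] mult.commute)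
    ultimately show ?thesis
      using \<open>c x \<noteq> 0\<close> by (auto intro: Lim_transform_eventually)
  qed
  \<comment> \<open>The products start at index 1, so the weights do not depend on the shock rate
    \<open>t\<close>.\<close>
  have upd: "(\<Prod>j=1..d. measure_pmf.prob (poisson_pmf ((\<theta>(0 := t)) j)) A) =
      (\<Prod>j=1..d. measure_pmf.prob (poisson_pmf (\<theta> j)) A)" for t A
    by (intro prod.cong) auto
  have "rv_cdf (M t) (max_rv d (X t)) (real x) = (\<Sum>k\<le>x. pmf (poisson_pmf t) k * a k)"
    if "0 < t" for t
    using rv_cdf_max[OF assms(2)[OF that] assms(1)] by (simp only: upd a_def fun_upd_same)
  moreover have "rv_cdf (M t) (min_rv d (X t)) (real x) = (\<Sum>k\<le>x. pmf (poisson_pmf t) k * b k)"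
    if "0 < t" for t
    using rv_cdf_min[OF assms(2)[OF that] assms(1)] by (simp only: upd b_def fun_upd_same)
  ultimately show ?thesis
    unfolding a[symmetric] b[symmetric] by (intro conjI key nz)
qed

end
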